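(* Let $(V,\mu)$ be an infinite, connected, locally finite weighted graph and let $1<p\le2$. Assume there is a constant $b>0$ such that $\mu(x)\ge b$ for all $x\in V$. If for some $o\in V$ there is a constant $C>0$ such that $$V(o,r)\le C\,\frac{r^{2p}}{\log r}\qquad\text{for all large enough } r,$$ then $(V,\mu)$ is $L^p$-parabolic.
   Context: Weighted graph: $(V,E)$ is an infinite, connected, locally finite graph (loops allowed), and $\mu:V\times V\to[0,\infty)$, $\mu_{xy}=\mu_{yx}$, with $\mu_{xy}>0$ iff $x\sim y$. Vertex weight: $\mu(x)=\sum_{y\sim x}\mu_{xy}$; $\mu(A)=\sum_{x\in A}\mu(x)$ for $A\subset V$. $d$ is the graph distance, $B(o,r)=\{x\in V: d(o,x)\le r\}$, $V(o,r)=\mu(B(o,r))$. Random walk: $P(x,y)=\mu_{xy}/\mu(x)$, with $n$-step transition function $P_n(x,y)$, $P_0(x,y)=\mathbf 1_{\{x=y\}}$, and $p_n(x,y)=P_n(x,y)/\mu(y)$. Green function: $g(x,y)=\sum_{n\ge0}p_n(x,y)\in(0,\infty]$. Green operator: for $f\ge0$, $Gf(x)=\sum_{y\in V}g(x,y)f(y)\mu(y)\in[0,\infty]$ (with $\infty\cdot0=0$). With $\frac1p+\frac1q=1$ and $\|f\|_{L^q(V)}=(\sum_{x\in V}|f(x)|^q\mu(x))^{1/q}$, the $L^p$-capacity of a finite set $K\subset V$ is $$C_p(K)=\sup\Big\{\Big(\sum_{x\in K}f(x)\mu(x)\Big)^p:\ f\ge0\text{ a function supported in }K,\ \|Gf\|_{L^q(V)}\le1\Big\}.$$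 $(V,\mu)$ is $L^p$-parabolic if $C_p(K)=0$ for every finite $K\subset V$. *)

theory Defs
  imports "HOL-Analysis.Analysis"
begin

text \<open>
  The adjacency relation is a symmetric set \<open>E\<close> of ordered pairs, so a loop at \<open>x\<close> is the
  single pair \<open>(x, x)\<close>. Values of \<open>\<mu>\<close> outside \<open>V \<times> V\<close> are irrelevant.
\<close>

locale weighted_graph =
  fixes V :: "'v set" and E :: "('v \<times> 'v) set" and \<mu> :: "'v \<Rightarrow> 'v \<Rightarrow> real"
  assumes edges_subset: "E \<subseteq> V \<times> V"
    and edges_sym: "sym E"
    and infinite_vertices: "infinite V"
    and connected_graph: "\<And>x y. x \<in> V \<Longrightarrow> y \<in> V \<Longrightarrow> (x, y) \<in> E\<^sup>*"
    and locally_finite: "\<And>x. x \<in> V \<Longrightarrow> finite (E `` {x})"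
    and weight_nonneg: "\<And>x y. x \<in> V \<Longrightarrow> y \<in> V \<Longrightarrow> 0 \<le> \<mu> x y"
    and weight_sym: "\<And>x y. x \<in> V \<Longrightarrow> y \<in> V \<Longrightarrow> \<mu> x y = \<mu> y x"
    and weight_pos_iff: "\<And>x y. x \<in> V \<Longrightarrow> y \<in> V \<Longrightarrow> 0 < \<mu> x y \<longleftrightarrow> (x, y) \<in> E"

definition vertex_weight :: "('v \<times> 'v) set \<Rightarrow> ('v \<Rightarrow> 'v \<Rightarrow> real) \<Rightarrow> 'v \<Rightarrow> real" where
  "vertex_weight E \<mu> x = (\<Sum>y\<in>E `` {x}. \<mu> x y)"

definition set_weight :: "('v \<times> 'v) set \<Rightarrow> ('v \<Rightarrow> 'v \<Rightarrow> real) \<Rightarrow> 'v set \<Rightarrow> ennreal" where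
  "set_weight E \<mu> A = (\<Sum>\<^sub>\<infinity>x\<in>A. ennreal (vertex_weight E \<mu> x))"

definition graph_dist :: "('v \<times> 'v) set \<Rightarrow> 'v \<Rightarrow> 'v \<Rightarrow> nat" where
  "graph_dist E x y = (LEAST n. (x, y) \<in> E ^^ n)"

definition graph_ball :: "'v set \<Rightarrow> ('v \<times> 'v) set \<Rightarrow> 'v \<Rightarrow> real \<Rightarrow> 'v set" where
  "graph_ball V E x r = {y \<in> V. real (graph_dist E x y) \<le> r}"

definition ball_volume ::
  "'v set \<Rightarrow> ('v \<times> 'v) set \<Rightarrow> ('v \<Rightarrow> 'v \<Rightarrow> real) \<Rightarrow> 'v \<Rightarrow> real \<Rightarrow> ennreal" where
  "ball_volume V E \<mu> x r = set_weight E \<mu> (graph_ball V E x r)"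

definition transition :: "('v \<times> 'v) set \<Rightarrow> ('v \<Rightarrow> 'v \<Rightarrow> real) \<Rightarrow> 'v \<Rightarrow> 'v \<Rightarrow> real" where
  "transition E \<mu> x y = \<mu> x y / vertex_weight E \<mu> x"

text \<open>
  Since \<open>transition E \<mu> x z = 0\<close> unless \<open>z\<close> is a neighbour of \<open>x\<close>, the Chapman--Kolmogorov sum
  over \<open>z \<in> V\<close> is a finite sum over the neighbours of \<open>x\<close>.
\<close>

primrec n_step ::
  "('v \<times> 'v) set \<Rightarrow> ('v \<Rightarrow> 'v \<Rightarrow> real) \<Rightarrow> nat \<Rightarrow> 'v \<Rightarrow> 'v \<Rightarrow> real" where
  "n_step E \<mu> 0 x y = (if x = y then 1 else 0)"
| "n_step E \<mu> (Suc n) x y = (\<Sum>z\<in>E `` {x}. transition E \<mu> x z * n_step E \<mu> n z y)"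

definition heat_kernel ::
  "('v \<times> 'v) set \<Rightarrow> ('v \<Rightarrow> 'v \<Rightarrow> real) \<Rightarrow> nat \<Rightarrow> 'v \<Rightarrow> 'v \<Rightarrow> real" where
  "heat_kernel E \<mu> n x y = n_step E \<mu> n x y / vertex_weight E \<mu> y"

definition green :: "('v \<times> 'v) set \<Rightarrow> ('v \<Rightarrow> 'v \<Rightarrow> real) \<Rightarrow> 'v \<Rightarrow> 'v \<Rightarrow> ennreal" where
  "green E \<mu> x y = (\<Sum>n. ennreal (heat_kernel E \<mu> n x y))"

definition green_op ::
  "'v set \<Rightarrow> ('v \<times> 'v) set \<Rightarrow> ('v \<Rightarrow> 'v \<Rightarrow> real) \<Rightarrow> ('v \<Rightarrow> real) \<Rightarrow> 'v \<Rightarrow> ennreal" where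
  "green_op V E \<mu> f x =
     (\<Sum>\<^sub>\<infinity>y\<in>V. green E \<mu> x y * ennreal (f y) * ennreal (vertex_weight E \<mu> y))"

text \<open>Real powers on \<open>[0, \<infinity>]\<close>, used for positive exponents only.\<close>

definition ennreal_powr :: "ennreal \<Rightarrow> real \<Rightarrow> ennreal" where
  "ennreal_powr u a = (if u = \<infinity> then \<infinity> else ennreal (enn2real u powr a))"

text \<open>
  The norm is defined for \<open>[0, \<infinity>]\<close>-valued functions, because \<open>Gf\<close> may take the value \<open>\<infinity>\<close>.
\<close>

definition Lq_norm ::
  "'v set \<Rightarrow> ('v \<times> 'v) set \<Rightarrow> ('v \<Rightarrow> 'v \<Rightarrow> real) \<Rightarrow> real \<Rightarrow> ('v \<Rightarrow> ennreal) \<Rightarrow> ennreal" where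
  "Lq_norm V E \<mu> q F =
     ennreal_powr (\<Sum>\<^sub>\<infinity>x\<in>V. ennreal_powr (F x) q * ennreal (vertex_weight E \<mu> x)) (1 / q)"

text \<open>For \<open>p > 1\<close>, the exponent \<open>q\<close> with \<open>1/p + 1/q = 1\<close> is \<open>p / (p - 1)\<close>.\<close>

definition Lp_capacity ::
  "'v set \<Rightarrow> ('v \<times> 'v) set \<Rightarrow> ('v \<Rightarrow> 'v \<Rightarrow> real) \<Rightarrow> real \<Rightarrow> 'v set \<Rightarrow> ennreal" where
  "Lp_capacity V E \<mu> p K =
     (SUP f \<in> {f :: 'v \<Rightarrow> real. (\<forall>x. 0 \<le> f x) \<and> (\<forall>x. x \<notin> K \<longrightarrow> f x = 0) \<and>
                  Lq_norm V E \<mu> (p / (p - 1)) (green_op V E \<mu> f) \<le> 1}.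
        ennreal ((\<Sum>x\<in>K. f x * vertex_weight E \<mu> x) powr p))"

definition Lp_parabolic ::
  "'v set \<Rightarrow> ('v \<times> 'v) set \<Rightarrow> ('v \<Rightarrow> 'v \<Rightarrow> real) \<Rightarrow> real \<Rightarrow> bool" where
  "Lp_parabolic V E \<mu> p \<longleftrightarrow> (\<forall>K. finite K \<and> K \<subseteq> V \<longrightarrow> Lp_capacity V E \<mu> p K = 0)"

end

theory Submission
  imports Defs "HOL-Real_Asymp.Real_Asymp"
begin

text \<open>
  If \<open>f(z) > 0\<close>, then \<open>Gf\<close> dominates a multiple of \<open>g(\<cdot>, z)\<close>, so it suffices that \<open>g(\<cdot>, z)\<close> is not in \<open>L\<^sup>q\<close>.
  Writing one factor of \<open>g\<^sup>q\<close> as \<open>\<Sum>\<^sub>k p\<^sub>k(\<cdot>, z)\<close> and applying Jensen's inequality, which needs \<open>q - 1 \<ge> 1\<close>, i.e.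
  \<open>p \<le> 2\<close>, gives \<open>\<parallel>g(\<cdot>, z)\<parallel>\<^sub>q\<^sup>q \<ge> \<Sum>\<^sub>k (\<Sum>\<^sub>j p\<^sub>k\<^sub>+\<^sub>j(z, z))\<^sup>q\<^sup>-\<^sup>1\<close>. The volume bound yields
  \<open>p\<^sub>2\<^sub>n(z, z) \<ge> 1 / (4 V(z, r)) \<ge> c (n log n)\<^sup>-\<^sup>p log n\<close> for \<open>r\<^sup>2 = K n log n\<close>, because the walk is in \<open>B(z, r)\<close>
  at time \<open>n\<close> with probability at least \<open>1/2\<close>. Hence the \<open>k\<close>-th term of the series is at least \<open>c / (k log k)\<close>,
  and the series diverges. The escape probability is controlled by a Carne--Varopoulos
  argument: \<open>P\<^sup>n\<close> is the average of the Chebyshev polynomials \<open>T\<^sub>k(P)\<close> at the position \<open>k\<close> of a simple random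
  walk on the integers at time \<open>n\<close>, and \<open>T\<^sub>k(P)\<close> is an \<open>L\<^sup>2\<close> contraction that moves mass by at most \<open>k\<close>.
\<close>

section \<open>Reversible operators on a finite set and their Chebyshev polynomials\<close>

text \<open>Row sums are only bounded by \<open>m\<close>, so the operator \<open>P\<close> below
  may lose mass. This admits a walk that is killed on leaving a ball.\<close>

locale finite_reversible =
  fixes S :: "'a set" and m :: "'a \<Rightarrow> real" and w :: "'a \<Rightarrow> 'a \<Rightarrow> real"
  assumes finite_S: "finite S"
    and m_pos: "\<And>x. x \<in> S \<Longrightarrow> 0 < m x"
    and w_nonneg: "\<And>x y. x \<in> S \<Longrightarrow> y \<in> S \<Longrightarrow> 0 \<le> w x y"
    and w_sym: "\<And>x y. x \<in> S \<Longrightarrow> y \<in> S \<Longrightarrow> w x y = w y x"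
    and w_sum_le: "\<And>x. x \<in> S \<Longrightarrow> (\<Sum>y\<in>S. w x y) \<le> m x"
begin

definition inner_S :: "('a \<Rightarrow> real) \<Rightarrow> ('a \<Rightarrow> real) \<Rightarrow> real" where
  "inner_S f h = (\<Sum>x\<in>S. m x * f x * h x)"

definition P :: "('a \<Rightarrow> real) \<Rightarrow> 'a \<Rightarrow> real" where
  "P f x = (\<Sum>y\<in>S. w x y * f y) / m x"

lemma inner_S_commute: "inner_S f h = inner_S h f"
  unfolding inner_S_def by (simp add: mult_ac)

lemma inner_S_nonneg: "0 \<le> inner_S f f"
  unfolding inner_S_def using m_pos by (intro sum_nonneg) (simp add: less_imp_le mult.assoc)

lemma inner_S_add: "inner_S (\<lambda>x. f x + g x) h = inner_S f h + inner_S g h"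
  unfolding inner_S_def by (simp add: algebra_simps sum.distrib)

lemma inner_S_add_right: "inner_S h (\<lambda>x. f x + g x) = inner_S h f + inner_S h g"
  unfolding inner_S_def by (simp add: algebra_simps sum.distrib)

lemma inner_S_diff: "inner_S (\<lambda>x. f x - g x) h = inner_S f h - inner_S g h"
  unfolding inner_S_def by (simp add: algebra_simps sum_subtractf)

lemma inner_S_diff_right: "inner_S h (\<lambda>x. f x - g x) = inner_S h f - inner_S h g"
  unfolding inner_S_def by (simp add: algebra_simps sum_subtractf)

lemma P_add: "P (\<lambda>x. f x + g x) = (\<lambda>x. P f x + P g x)"
  unfolding P_def by (simp add: algebra_simps sum.distrib add_divide_distrib)

lemma P_diff: "P (\<lambda>x. f x - g x) = (\<lambda>x. P f x - P g x)"
  unfolding P_def by (simp add: algebra_simps sum_subtractf diff_divide_distrib)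

lemma P_scale: "P (\<lambda>x. c * f x) = (\<lambda>x. c * P f x)"
  unfolding P_def by (simp add: mult.left_commute[of _ c] sum_distrib_left[symmetric])

lemma P_pow_add: "(P ^^ n) (\<lambda>x. f x + g x) = (\<lambda>x. (P ^^ n) f x + (P ^^ n) g x)"
  by (induction n) (simp_all add: P_add)

lemma P_pow_scale: "(P ^^ n) (\<lambda>x. c * f x) = (\<lambda>x. c * (P ^^ n) f x)"
  by (induction n) (simp_all add: P_scale)

lemma inner_P: "inner_S (P f) h = (\<Sum>x\<in>S. \<Sum>y\<in>S. w x y * f y * h x)"
proof -
  have "m x * P f x * h x = (\<Sum>y\<in>S. w x y * f y * h x)" if "x \<in> S" for x
    using m_pos[OF that] by (simp add: P_def sum_distrib_right)
  then show ?thesis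
    unfolding inner_S_def by (intro sum.cong) auto
qed

text \<open>The factor \<open>m x\<close> cancels the denominator in \<open>P\<close>, which leaves
  a bilinear form with the symmetric kernel \<open>w\<close>.\<close>

lemma P_self_adjoint: "inner_S (P f) h = inner_S f (P h)"
proof -
  have "inner_S (P f) h = (\<Sum>y\<in>S. \<Sum>x\<in>S. w x y * f y * h x)"
    unfolding inner_P by (rule sum.swap)
  also have "\<dots> = (\<Sum>y\<in>S. \<Sum>x\<in>S. w y x * h x * f y)"
    using w_sym by (intro sum.cong) auto
  also have "\<dots> = inner_S (P h) f"
    unfolding inner_P by simp
  finally show ?thesis by (simp add: inner_S_commute)
qed

lemma P_pow_self_adjoint: "inner_S ((P ^^ n) f) h = inner_S f ((P ^^ n) h)"
proof (induction n arbitrary: h)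
  case (Suc n)
  have "inner_S ((P ^^ Suc n) f) h = inner_S ((P ^^ n) f) (P h)"
    by (simp add: P_self_adjoint)
  then show ?case by (simp add: Suc.IH funpow_swap1)
qed simp

text \<open>Schur test: after Young's inequality, the row sums of \<open>w\<close> and, by symmetry,
  its column sums are bounded by \<open>m\<close>. Half of the norm of \<open>P f\<close> then
  reappears on the right and is absorbed.\<close>

lemma P_contraction: "inner_S (P f) (P f) \<le> inner_S f f"
proof -
  have young: "f y * P f x \<le> (f y)\<^sup>2 / 2 + (P f x)\<^sup>2 / 2" for x y
    using sum_squares_bound[of "f y" "P f x"] by simp
  have "inner_S (P f) (P f) = (\<Sum>x\<in>S. \<Sum>y\<in>S. w x y * (f y * P f x))"
    unfolding inner_P by (simp add: mult_ac)
  also have "\<dots> \<le> (\<Sum>x\<in>S. \<Sum>y\<in>S. w x y * ((f y)\<^sup>2 / 2 + (P f x)\<^sup>2 / 2))"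
    by (intro sum_mono mult_left_mono w_nonneg young)
  also have "\<dots> = (\<Sum>x\<in>S. \<Sum>y\<in>S. w x y * ((f y)\<^sup>2 / 2)) + (\<Sum>x\<in>S. (\<Sum>y\<in>S. w x y) * ((P f x)\<^sup>2 / 2))"
    by (simp only: distrib_left sum.distrib sum_distrib_right)
  also have "(\<Sum>x\<in>S. \<Sum>y\<in>S. w x y * ((f y)\<^sup>2 / 2)) = (\<Sum>y\<in>S. \<Sum>x\<in>S. w x y * ((f y)\<^sup>2 / 2))"
    by (rule sum.swap)
  also have "\<dots> = (\<Sum>y\<in>S. (\<Sum>x\<in>S. w y x) * ((f y)\<^sup>2 / 2))"
    using w_sym by (intro sum.cong) (auto simp: sum_distrib_right)
  also have "\<dots> + (\<Sum>x\<in>S. (\<Sum>y\<in>S. w x y) * ((P f x)\<^sup>2 / 2))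
      \<le> (\<Sum>y\<in>S. m y * ((f y)\<^sup>2 / 2)) + (\<Sum>x\<in>S. m x * ((P f x)\<^sup>2 / 2))"
    by (intro add_mono sum_mono mult_right_mono w_sum_le) auto
  also have "\<dots> = inner_S f f / 2 + inner_S (P f) (P f) / 2"
    unfolding inner_S_def by (simp add: sum_divide_distrib power2_eq_square mult_ac)
  finally show ?thesis by simp
qed

text \<open>
  The two components are \<open>T\<^sub>k(P) \<delta>\<close> and \<open>U\<^sub>k\<^sub>-\<^sub>1(P) \<delta>\<close> for the Chebyshev polynomials of the first and
  second kind. The joint recursion is a rotation, which makes the Pell identity
  \<open>T\<^sub>k\<^sup>2 + (1 - P\<^sup>2) U\<^sub>k\<^sub>-\<^sub>1\<^sup>2 = 1\<close> a conserved quantity.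
\<close>

primrec chebyshev :: "nat \<Rightarrow> ('a \<Rightarrow> real) \<Rightarrow> ('a \<Rightarrow> real) \<times> ('a \<Rightarrow> real)" where
  "chebyshev 0 \<delta> = (\<delta>, \<lambda>_. 0)"
| "chebyshev (Suc k) \<delta> =
     (let (t, s) = chebyshev k \<delta>
      in (\<lambda>x. P t x - (s x - P (P s) x), \<lambda>x. P s x + t x))"

definition cheb_T :: "nat \<Rightarrow> ('a \<Rightarrow> real) \<Rightarrow> 'a \<Rightarrow> real" where
  "cheb_T k \<delta> = fst (chebyshev k \<delta>)"

definition cheb_U :: "nat \<Rightarrow> ('a \<Rightarrow> real) \<Rightarrow> 'a \<Rightarrow> real" where
  "cheb_U k \<delta> = snd (chebyshev k \<delta>)"

lemma P_zero: "P (\<lambda>_. 0) = (\<lambda>_. 0)"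
  by (simp add: P_def fun_eq_iff)

lemma cheb_T_0: "cheb_T 0 \<delta> = \<delta>"
  and cheb_U_0: "cheb_U 0 \<delta> = (\<lambda>_. 0)"
  by (simp_all add: cheb_T_def cheb_U_def)

lemma cheb_T_rotate:
    "cheb_T (Suc k) \<delta> = (\<lambda>x. P (cheb_T k \<delta>) x - (cheb_U k \<delta> x - P (P (cheb_U k \<delta>)) x))"
  and cheb_U_rotate:
    "cheb_U (Suc k) \<delta> = (\<lambda>x. P (cheb_U k \<delta>) x + cheb_T k \<delta> x)"
  by (simp_all add: cheb_T_def cheb_U_def split: prod.split)

lemma cheb_T_1: "cheb_T (Suc 0) \<delta> = P \<delta>"
  by (simp add: cheb_T_rotate cheb_T_0 cheb_U_0 P_zero)

text \<open>The second component drops out of the rotation. The resulting recurrence says that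
  \<open>P\<close> acts on the index of \<open>cheb_T\<close> as a step of the simple random
  walk.\<close>

lemma cheb_T_Suc_Suc:
  "cheb_T (Suc (Suc k)) \<delta> x + cheb_T k \<delta> x = 2 * P (cheb_T (Suc k) \<delta>) x"
  unfolding cheb_T_rotate[of "Suc k"] cheb_T_rotate[of k] cheb_U_rotate[of k]
  by (simp add: P_add P_diff)

text \<open>Since \<open>t' = P s' - s\<close>, the squares of \<open>P s'\<close> cancel, and
  self-adjointness removes the cross terms.\<close>

lemma pell_step:
  fixes t s :: "'a \<Rightarrow> real"
  defines "t' \<equiv> \<lambda>x. P t x - (s x - P (P s) x)" and "s' \<equiv> \<lambda>x. P s x + t x"
  shows "inner_S t' t' + inner_S s' s' - inner_S (P s') (P s')
       = inner_S t t + inner_S s s - inner_S (P s) (P s)"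
proof -
  have "inner_S s (P (P s)) = inner_S (P s) (P s)" "inner_S (P (P s)) s = inner_S (P s) (P s)"
    and "inner_S (P t) s = inner_S t (P s)" "inner_S s (P t) = inner_S t (P s)"
    and "inner_S (P s) t = inner_S t (P s)"
    using P_self_adjoint[of s "P s"] P_self_adjoint[of "P s" s] P_self_adjoint[of t s]
      inner_S_commute[of s "P t"] inner_S_commute[of "P s" t] by auto
  moreover have "inner_S (P (P s)) (P t) = inner_S (P t) (P (P s))"
    by (rule inner_S_commute)
  ultimately show ?thesis
    unfolding t'_def s'_def P_add inner_S_add inner_S_add_right inner_S_diff inner_S_diff_right
    by simp
qed

text \<open>\<open>P_contraction\<close> makes the contribution of \<open>cheb_U\<close> to the
  conserved quantity nonnegative. This replaces the spectral argument from |T_k| <= 1 on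
  [-1, 1].\<close>

lemma cheb_T_norm_le: "inner_S (cheb_T k \<delta>) (cheb_T k \<delta>) \<le> inner_S \<delta> \<delta>"
proof -
  have "inner_S (cheb_T k \<delta>) (cheb_T k \<delta>) + inner_S (cheb_U k \<delta>) (cheb_U k \<delta>)
      - inner_S (P (cheb_U k \<delta>)) (P (cheb_U k \<delta>)) = inner_S \<delta> \<delta>"
  proof (induction k)
    case 0
    show ?case by (simp add: cheb_T_0 cheb_U_0 P_zero inner_S_def)
  next
    case (Suc k)
    then show ?case
      unfolding cheb_T_rotate cheb_U_rotate pell_step .
  qed
  then show ?thesis using P_contraction[of "cheb_U k \<delta>"] by linarith
qed

text \<open>Cauchy-Schwarz for the measure \<open>m\<close>. It converts L2 bounds into bounds on
  mass, for the tail of the walk and later for the return probability.\<close>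

lemma abs_sum_le_inner:
  assumes "A \<subseteq> S"
  shows "(\<Sum>x\<in>A. m x * \<bar>f x\<bar>) \<le> sqrt (sum m A * inner_S f f)"
proof (rule real_le_rsqrt)
  have pos: "0 \<le> m x" if "x \<in> S" for x using m_pos[OF that] by simp
  have "(\<Sum>x\<in>A. m x * \<bar>f x\<bar>)\<^sup>2 = (\<Sum>x\<in>A. sqrt (m x) * (sqrt (m x) * \<bar>f x\<bar>))\<^sup>2"
    using assms pos by (intro arg_cong[where f = "\<lambda>u. u\<^sup>2"] sum.cong) (auto simp flip: mult.assoc)
  also have "\<dots> \<le> (\<Sum>x\<in>A. (sqrt (m x))\<^sup>2) * (\<Sum>x\<in>A. (sqrt (m x) * \<bar>f x\<bar>)\<^sup>2)"
    by (rule Cauchy_Schwarz_ineq_sum)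
  also have "\<dots> = sum m A * (\<Sum>x\<in>A. m x * (f x)\<^sup>2)"
    using assms pos
    by (intro arg_cong2[where f = "(*)"] sum.cong) (auto simp: power_mult_distrib subset_iff)
  also have "\<dots> \<le> sum m A * inner_S f f"
    unfolding inner_S_def mult.assoc power2_eq_square using assms pos finite_S
    by (intro mult_left_mono sum_mono2 sum_nonneg) auto
  finally show "(\<Sum>x\<in>A. m x * \<bar>f x\<bar>)\<^sup>2 \<le> sum m A * inner_S f f" .
qed

end

section \<open>Finite propagation speed and the Carne-Varopoulos tail bound\<close>

locale finite_reversible_dist = finite_reversible +
  fixes d :: "'a \<Rightarrow> nat" and \<delta> :: "'a \<Rightarrow> real"
  assumes w_dist: "\<And>x y. x \<in> S \<Longrightarrow> y \<in> S \<Longrightarrow> w x y \<noteq> 0 \<Longrightarrow> d x \<le> Suc (d y)"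
    and \<delta>_support: "\<And>x. x \<in> S \<Longrightarrow> \<delta> x \<noteq> 0 \<Longrightarrow> d x = 0"
begin

lemma P_support:
  assumes "\<And>x. x \<in> S \<Longrightarrow> f x \<noteq> 0 \<Longrightarrow> d x \<le> k" "x \<in> S" "P f x \<noteq> 0"
  shows "d x \<le> Suc k"
proof -
  obtain y where "y \<in> S" "w x y * f y \<noteq> 0"
    using assms(3) unfolding P_def by (auto elim: sum.not_neutral_contains_not_neutral)
  then show ?thesis using w_dist[of x y] assms(1)[of y] assms(2) by fastforce
qed

text \<open>T_k is a polynomial of degree k in \<open>P\<close>, and each \<open>P\<close> enlarges
  the support by one. The recurrence reaches two indices back, hence the strong induction.\<close>

lemma cheb_T_support: "x \<in> S \<Longrightarrow> cheb_T k \<delta> x \<noteq> 0 \<Longrightarrow> d x \<le> k"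
proof (induction k arbitrary: x rule: less_induct)
  case (less k)
  consider "k = 0" | "k = Suc 0" | j where "k = Suc (Suc j)"
    by (metis not0_implies_Suc)
  then show ?case
  proof cases
    case 1
    then show ?thesis using less.prems \<delta>_support by (simp add: cheb_T_0)
  next
    case 2
    then show ?thesis using less.prems \<delta>_support P_support[of \<delta> 0 x] by (simp add: cheb_T_1)
  next
    case 3
    then have "cheb_T j \<delta> x \<noteq> 0 \<or> P (cheb_T (Suc j) \<delta>) x \<noteq> 0"
      using less.prems cheb_T_Suc_Suc[of j \<delta> x] by auto
    then show ?thesis
      using less.IH[of j x] less.prems 3 P_support[of "cheb_T (Suc j) \<delta>" "Suc j" x] less.IH[of "Suc j"]
      by (metis le_SucI lessI less_Suc_eq)
  qed
qed

lemma ball_mass_nonneg: "0 \<le> sqrt (sum m {x\<in>S. d x \<le> N} * inner_S \<delta> \<delta>)"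
proof -
  have "0 \<le> sum m {x\<in>S. d x \<le> N}"
    by (intro sum_nonneg) (simp add: m_pos less_imp_le)
  then show ?thesis using inner_S_nonneg[of \<delta>] by simp
qed

text \<open>The sum vanishes for \<open>k \<le> r\<close> by the support; otherwise the norm bound
  applies and exp(\<theta> (k - r)) >= 1. The larger factor with \<open>cosh\<close> is chosen
  because it behaves well under averaging over neighbouring indices.\<close>

lemma cheb_T_tail:
  assumes "0 \<le> \<theta>" "k \<le> N"
  shows "(\<Sum>x | x \<in> S \<and> r < real (d x). m x * \<bar>cheb_T k \<delta> x\<bar>)
    \<le> sqrt (sum m {x\<in>S. d x \<le> N} * inner_S \<delta> \<delta>) * exp (- \<theta> * r) * (2 * cosh (\<theta> * real k))"
    (is "?L \<le> ?M * _ * _")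
proof -
  have M: "0 \<le> ?M"
    by (rule ball_mass_nonneg)
  show ?thesis
  proof (cases "real k \<le> r")
    case True
    have "?L = 0"
    proof (intro sum.neutral ballI)
      fix x assume "x \<in> {x. x \<in> S \<and> r < real (d x)}"
      then have "x \<in> S" "k < d x" using True by auto
      then show "m x * \<bar>cheb_T k \<delta> x\<bar> = 0" using cheb_T_support[of x k] by fastforce
    qed
    then show ?thesis using M by (simp add: cosh_real_nonneg)
  next
    case False
    have "?L \<le> (\<Sum>x | x \<in> S \<and> d x \<le> k. m x * \<bar>cheb_T k \<delta> x\<bar>)"
    proof (rule order_trans)
      show "?L \<le> (\<Sum>x\<in>S. m x * \<bar>cheb_T k \<delta> x\<bar>)"
        using m_pos finite_S by (intro sum_mono2) (auto simp: less_imp_le)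
      have "(\<Sum>x\<in>S. m x * \<bar>cheb_T k \<delta> x\<bar>) = (\<Sum>x | x \<in> S \<and> d x \<le> k. m x * \<bar>cheb_T k \<delta> x\<bar>)"
      proof (rule sum.mono_neutral_right)
        show "\<forall>x\<in>S - {x. x \<in> S \<and> d x \<le> k}. m x * \<bar>cheb_T k \<delta> x\<bar> = 0"
        proof
          fix x assume "x \<in> S - {x. x \<in> S \<and> d x \<le> k}"
          then show "m x * \<bar>cheb_T k \<delta> x\<bar> = 0" using cheb_T_support[of x k] by auto
        qed
      qed (auto simp: finite_S)
      then show "(\<Sum>x\<in>S. m x * \<bar>cheb_T k \<delta> x\<bar>) \<le> (\<Sum>x | x \<in> S \<and> d x \<le> k. m x * \<bar>cheb_T k \<delta> x\<bar>)"
        by simp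
    qed
    also have "\<dots> \<le> sqrt (sum m {x\<in>S. d x \<le> k} * inner_S (cheb_T k \<delta>) (cheb_T k \<delta>))"
      by (rule abs_sum_le_inner[of "{x\<in>S. d x \<le> k}" "cheb_T k \<delta>"]) (rule Collect_restrict)
    also have "\<dots> \<le> ?M"
    proof (intro real_sqrt_le_mono mult_mono)
      show "sum m {x\<in>S. d x \<le> k} \<le> sum m {x\<in>S. d x \<le> N}"
        using m_pos finite_S assms(2) by (intro sum_mono2) (auto simp: less_imp_le)
      show "0 \<le> sum m {x\<in>S. d x \<le> N}"
        using m_pos by (intro sum_nonneg) (auto simp: less_imp_le)
    qed (rule cheb_T_norm_le inner_S_nonneg)+
    also have "\<dots> \<le> ?M * (exp (- \<theta> * r) * (2 * cosh (\<theta> * real k)))"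
    proof -
      have "1 \<le> exp (- \<theta> * r) * exp (\<theta> * real k)"
        using False assms(1) by (simp add: mult_left_mono flip: exp_add)
      also have "\<dots> \<le> exp (- \<theta> * r) * (2 * cosh (\<theta> * real k))"
        by (simp add: cosh_field_def)
      finally have "1 \<le> exp (- \<theta> * r) * (2 * cosh (\<theta> * real k))" .
      from mult_left_mono[OF this M] show ?thesis by (simp only: mult_1_right)
    qed
    finally show ?thesis by (simp only: mult.assoc)
  qed
qed

text \<open>As a function of the index k, cosh(\<theta> k) is an eigenfunction of the simple random
  walk with eigenvalue \<open>cosh \<theta>\<close>, so each \<open>P\<close> costs one such factor.
  The hypothesis \<open>n + k \<le> N\<close> keeps all indices met on the way at most
  \<open>N\<close>.\<close>

lemma P_pow_cheb_T_tail:
  assumes "0 \<le> \<theta>" "n + k \<le> N"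
  shows "(\<Sum>x | x \<in> S \<and> r < real (d x). m x * \<bar>(P ^^ n) (cheb_T k \<delta>) x\<bar>)
    \<le> sqrt (sum m {x\<in>S. d x \<le> N} * inner_S \<delta> \<delta>) * exp (- \<theta> * r) * (2 * cosh (\<theta> * real k)) * cosh \<theta> ^ n"
  using assms(2)
proof (induction n arbitrary: k)
  case 0
  then show ?case using cheb_T_tail[OF assms(1), of k N r] by simp
next
  case (Suc n)
  let ?M = "sqrt (sum m {x\<in>S. d x \<le> N} * inner_S \<delta> \<delta>) * exp (- \<theta> * r)"
  let ?tail = "\<lambda>f. \<Sum>x | x \<in> S \<and> r < real (d x). m x * \<bar>f x\<bar>"
  show ?case
  proof (cases k)
    case 0
    \<comment> \<open>Reflection at index 0: both neighbours are T_1 = P T_0, which matches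
      \<open>cosh\<close> being even.\<close>
    have "(P ^^ Suc n) (cheb_T 0 \<delta>) = (P ^^ n) (cheb_T (Suc 0) \<delta>)"
      by (simp add: cheb_T_0 cheb_T_1 funpow_swap1)
    then show ?thesis using Suc.IH[of "Suc 0"] Suc.prems 0 by (simp add: mult_ac)
  next
    case (Suc j)
    have step: "P (cheb_T (Suc j) \<delta>) = (\<lambda>x. (1/2) * (cheb_T (Suc (Suc j)) \<delta> x + cheb_T j \<delta> x))"
      using cheb_T_Suc_Suc[of j \<delta>] by (simp add: fun_eq_iff)
    have "(P ^^ Suc n) (cheb_T k \<delta>) = (P ^^ n) (P (cheb_T (Suc j) \<delta>))"
      by (simp add: Suc funpow_swap1)
    also have "\<dots> =
        (\<lambda>x. (1/2) * ((P ^^ n) (cheb_T (Suc (Suc j)) \<delta>) x + (P ^^ n) (cheb_T j \<delta>) x))"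
      unfolding step P_pow_scale P_pow_add ..
    finally have "?tail ((P ^^ Suc n) (cheb_T k \<delta>)) \<le>
        (\<Sum>x | x \<in> S \<and> r < real (d x). (1/2) * (m x * \<bar>(P ^^ n) (cheb_T (Suc (Suc j)) \<delta>) x\<bar>
           + m x * \<bar>(P ^^ n) (cheb_T j \<delta>) x\<bar>))"
      using m_pos
      by (auto intro!: sum_mono simp: abs_mult distrib_left[symmetric] less_imp_le mult_left_mono)
    also have "\<dots> = (1/2) * (?tail ((P ^^ n) (cheb_T (Suc (Suc j)) \<delta>)) + ?tail ((P ^^ n) (cheb_T j \<delta>)))"
      by (simp only: sum.distrib sum_distrib_left[symmetric])
    also have "\<dots> \<le> (1/2) * (?M * (2 * cosh (\<theta> * real (Suc (Suc j)))) * cosh \<theta> ^ n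
                           + ?M * (2 * cosh (\<theta> * real j)) * cosh \<theta> ^ n)"
      using Suc.prems Suc by (intro mult_left_mono add_mono Suc.IH) auto
    also have "\<dots> = ?M * (cosh (\<theta> * real k + \<theta>) + cosh (\<theta> * real k - \<theta>)) * cosh \<theta> ^ n"
      by (simp add: Suc algebra_simps)
    also have "\<dots> = ?M * (2 * cosh (\<theta> * real k)) * cosh \<theta> ^ Suc n"
      by (simp add: cosh_add cosh_diff)
    finally show ?thesis .
  qed
qed

lemma P_pow_tail:
  assumes "0 \<le> r" "r \<le> 2 * real n"
  shows "(\<Sum>x | x \<in> S \<and> r < real (d x). m x * \<bar>(P ^^ n) \<delta> x\<bar>)
    \<le> 2 * sqrt (sum m {x\<in>S. d x \<le> n} * inner_S \<delta> \<delta>) * exp (- r\<^sup>2 / (4 * real n))"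
proof (cases "n = 0")
  case True
  \<comment> \<open>At time 0 all mass sits at distance 0, so the left side vanishes and the right
    side need only be nonnegative.\<close>
  then have "r = 0" using assms by simp
  moreover have "{x. x \<in> S \<and> 0 < d x \<and> \<delta> x \<noteq> 0} = {}" using \<delta>_support by auto
  then have "(\<Sum>x | x \<in> S \<and> 0 < d x. m x * \<bar>\<delta> x\<bar>) = 0"
    by (intro sum.neutral) auto
  ultimately show ?thesis using True ball_mass_nonneg[of n] by simp
next
  case False
  \<comment> \<open>This \<theta> minimises -\<theta> r + n \<theta>^2. The hypothesis
    \<open>r \<le> 2 * real n\<close> gives \<open>\<theta> \<le> 1\<close>, where cosh \<theta> <=
    1 + \<theta>^2 is available.\<close>
  define \<theta> where "\<theta> = r / (2 * real n)"
  have \<theta>: "0 \<le> \<theta>" "\<theta> \<le> 1" using assms False by (auto simp: \<theta>_def field_simps)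
  let ?M = "sqrt (sum m {x\<in>S. d x \<le> n} * inner_S \<delta> \<delta>)"
  have M: "0 \<le> ?M"
    by (rule ball_mass_nonneg)
  have "exp (- \<theta>) \<le> 1 - \<theta> + \<theta>\<^sup>2"
  proof -
    have "1 + \<theta> \<le> exp \<theta>" by (rule exp_ge_add_one_self)
    moreover have "1 \<le> (1 - \<theta> + \<theta>\<^sup>2) * (1 + \<theta>)"
    proof -
      have "(1 - \<theta> + \<theta>\<^sup>2) * (1 + \<theta>) = 1 + \<theta> * \<theta> * \<theta>"
        by (simp add: algebra_simps power2_eq_square)
      then show ?thesis using \<theta> by simp
    qed
    moreover have "0 \<le> 1 - \<theta> + \<theta>\<^sup>2" using \<theta> by simp
    ultimately have "1 \<le> (1 - \<theta> + \<theta>\<^sup>2) * exp \<theta>"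
      by (meson mult_left_mono order_trans)
    then show ?thesis by (simp add: exp_minus field_simps)
  qed
  moreover have "exp \<theta> \<le> 1 + \<theta> + \<theta>\<^sup>2" using exp_bound \<theta> by blast
  ultimately have "cosh \<theta> \<le> 1 + \<theta>\<^sup>2" by (simp add: cosh_field_def)
  also have "\<dots> \<le> exp (\<theta>\<^sup>2)" by (rule exp_ge_add_one_self)
  finally have "cosh \<theta> ^ n \<le> exp (\<theta>\<^sup>2) ^ n"
    by (intro power_mono) (simp_all add: cosh_real_nonneg)
  also have "\<dots> = exp (real n * \<theta>\<^sup>2)" by (simp add: exp_of_nat_mult)
  finally have c: "cosh \<theta> ^ n \<le> exp (real n * \<theta>\<^sup>2)" .
  have "(\<Sum>x | x \<in> S \<and> r < real (d x). m x * \<bar>(P ^^ n) \<delta> x\<bar>) \<le> ?M * exp (- \<theta> * r) * 2 * cosh \<theta> ^ n"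
    using P_pow_cheb_T_tail[of \<theta> n 0 n r] \<theta> by (simp add: cheb_T_0)
  also have "\<dots> \<le> ?M * exp (- \<theta> * r) * 2 * exp (real n * \<theta>\<^sup>2)"
    using c M by (intro mult_left_mono) auto
  also have "\<dots> = 2 * ?M * exp (- \<theta> * r + real n * \<theta>\<^sup>2)"
    by (subst exp_add) simp
  also have "- \<theta> * r + real n * \<theta>\<^sup>2 = - r\<^sup>2 / (4 * real n)"
    using False by (simp add: \<theta>_def field_simps power2_eq_square)
  finally show ?thesis .
qed

end

text \<open>Convexity enters as the tangent line at the mean \<open>A\<close>. It comes from Young's
  inequality with exponents \<open>s\<close> and \<open>s / (s - 1)\<close>, which also covers zero
  values; \<open>s = 1\<close> has no conjugate exponent and is split off.\<close>

lemma powr_jensen: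
  fixes w y :: "'a \<Rightarrow> real"
  assumes "1 \<le> s" "sum w S = 1"
    and "\<And>i. i \<in> S \<Longrightarrow> 0 \<le> w i" "\<And>i. i \<in> S \<Longrightarrow> 0 \<le> y i"
  shows "(\<Sum>i\<in>S. w i * y i) powr s \<le> (\<Sum>i\<in>S. w i * y i powr s)"
proof (cases "s = 1")
  case True
  then show ?thesis using assms by (simp add: sum_nonneg powr_one_gt_zero_iff)
next
  case False
  with assms have s: "1 < s" by simp
  define A where "A = (\<Sum>i\<in>S. w i * y i)"
  have A: "0 \<le> A" unfolding A_def using assms by (simp add: sum_nonneg)
  have tangent: "s * y i * A powr (s - 1) - (s - 1) * A powr s \<le> y i powr s" if "i \<in> S" for i
  proof -
    have "y i * A powr (s - 1) \<le> y i powr s / s + (A powr (s - 1)) powr (s / (s - 1)) / (s / (s - 1))"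
      using s assms(4)[OF that] by (intro Youngs_inequality) (auto simp: field_simps)
    also have "(A powr (s - 1)) powr (s / (s - 1)) = A powr s"
      using s by (simp add: powr_powr)
    finally show ?thesis using s by (simp add: field_simps)
  qed
  have "A powr s = s * A * A powr (s - 1) - (s - 1) * A powr s"
    using powr_mult_base[OF A, of "s - 1"] by (simp add: algebra_simps)
  also have "\<dots> = (\<Sum>i\<in>S. w i * (s * y i * A powr (s - 1))) - (\<Sum>i\<in>S. w i * ((s - 1) * A powr s))"
    unfolding sum_distrib_right[symmetric] assms(2)
    by (simp add: A_def sum_distrib_left sum_distrib_right mult_ac)
  also have "\<dots> = (\<Sum>i\<in>S. w i * (s * y i * A powr (s - 1) - (s - 1) * A powr s))"
    by (simp add: sum_subtractf right_diff_distrib)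
  also have "\<dots> \<le> (\<Sum>i\<in>S. w i * y i powr s)"
    using assms(3) tangent by (intro sum_mono mult_left_mono)
  finally show ?thesis unfolding A_def .
qed

section \<open>Distances, balls and step probabilities of the weighted graph\<close>

context weighted_graph
begin

lemma relpow_sym: "(x, y) \<in> E ^^ n \<Longrightarrow> (y, x) \<in> E ^^ n"
proof (induction n arbitrary: y)
  case (Suc n)
  then obtain u where "(x, u) \<in> E ^^ n" "(u, y) \<in> E" by auto
  then show ?case using Suc.IH[of u] symD[OF edges_sym, of u y] by (intro relpow_Suc_I2)
qed auto

lemma edge_vertices: "(x, y) \<in> E \<Longrightarrow> x \<in> V" "(x, y) \<in> E \<Longrightarrow> y \<in> V"
  using edges_subset by auto

lemma graph_dist_le: "(x, y) \<in> E ^^ n \<Longrightarrow> graph_dist E x y \<le> n"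
  unfolding graph_dist_def by (rule Least_le)

lemma relpow_graph_dist: "x \<in> V \<Longrightarrow> y \<in> V \<Longrightarrow> (x, y) \<in> E ^^ graph_dist E x y"
  unfolding graph_dist_def using connected_graph[of x y]
  by (auto intro: LeastI dest: rtrancl_imp_relpow)

lemma graph_dist_triangle:
  "x \<in> V \<Longrightarrow> y \<in> V \<Longrightarrow> z \<in> V \<Longrightarrow> graph_dist E x z \<le> graph_dist E x y + graph_dist E y z"
  by (intro graph_dist_le) (simp add: relpow_add relcompI[OF relpow_graph_dist relpow_graph_dist])

lemma graph_dist_refl: "graph_dist E x x = 0"
  using graph_dist_le[of x x 0] by simp

lemma graph_dist_edge:
  assumes "z \<in> V" "(x, y) \<in> E"
  shows "graph_dist E z y \<le> Suc (graph_dist E z x)"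
  using relpow_graph_dist[of z x] assms edge_vertices by (intro graph_dist_le) auto

lemma finite_relpow_Image: "x \<in> V \<Longrightarrow> finite ((E ^^ n) `` {x})"
proof (induction n)
  case (Suc n)
  have "(E ^^ Suc n) `` {x} = (\<Union>y\<in>(E ^^ n) `` {x}. E `` {y})" by auto
  moreover have "finite (E `` {y})" for y
  proof (cases "y \<in> V")
    case False
    then have "E `` {y} = {}" using edge_vertices(1) by blast
    then show ?thesis by simp
  qed (rule locally_finite)
  ultimately show ?case using Suc by simp
qed simp

lemma graph_ball_iff: "y \<in> graph_ball V E x r \<longleftrightarrow> y \<in> V \<and> real (graph_dist E x y) \<le> r"
  by (simp add: graph_ball_def)

lemma finite_graph_ball: "x \<in> V \<Longrightarrow> finite (graph_ball V E x r)"
proof (rule finite_subset)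
  assume "x \<in> V"
  show "graph_ball V E x r \<subseteq> (\<Union>n\<le>nat \<lfloor>r\<rfloor>. (E ^^ n) `` {x})"
  proof
    fix y assume "y \<in> graph_ball V E x r"
    then have "y \<in> V" "graph_dist E x y \<le> nat \<lfloor>r\<rfloor>" by (auto simp: graph_ball_iff le_nat_floor)
    with relpow_graph_dist[OF \<open>x \<in> V\<close> this(1)] show "y \<in> (\<Union>n\<le>nat \<lfloor>r\<rfloor>. (E ^^ n) `` {x})"
      by blast
  qed
qed (simp add: finite_relpow_Image)

text \<open>An infinite vertex set supplies some \<open>y \<noteq> x\<close>, and the first edge of
  a path to \<open>y\<close> has positive weight.\<close>

lemma vertex_weight_pos:
  assumes "x \<in> V"
  shows "0 < vertex_weight E \<mu> x"
proof -
  have "infinite (V - {x})" using infinite_vertices by simp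
  then obtain y where y: "y \<in> V" "y \<noteq> x"
    using infinite_imp_nonempty by blast
  with connected_graph[OF assms y(1)] obtain u where "(x, u) \<in> E"
    by (auto elim: converse_rtranclE)
  then show ?thesis
    unfolding vertex_weight_def using edges_subset locally_finite[OF assms] weight_pos_iff
    by (intro sum_pos) auto
qed

text \<open>A real-valued form of \<open>ball_volume\<close>; the two agree because balls are
  finite.\<close>

definition volume :: "'v \<Rightarrow> real \<Rightarrow> real" where
  "volume x r = sum (vertex_weight E \<mu>) (graph_ball V E x r)"

lemma ball_volume_eq: "x \<in> V \<Longrightarrow> ball_volume V E \<mu> x r = ennreal (volume x r)"
  unfolding ball_volume_def set_weight_def volume_def
  by (subst infsum_finite)
    (auto simp: finite_graph_ball graph_ball_iff intro!: sum_ennreal less_imp_le vertex_weight_pos)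

lemma volume_mono: "x \<in> V \<Longrightarrow> r \<le> r' \<Longrightarrow> volume x r \<le> volume x r'"
  unfolding volume_def
  by (intro sum_mono2) (auto simp: finite_graph_ball graph_ball_iff less_imp_le vertex_weight_pos)

lemma volume_shift:
  assumes "x \<in> V" "y \<in> V"
  shows "volume y r \<le> volume x (r + real (graph_dist E x y))"
  unfolding volume_def
proof (intro sum_mono2 finite_graph_ball assms)
  show "graph_ball V E y r \<subseteq> graph_ball V E x (r + real (graph_dist E x y))"
  proof
    fix u assume "u \<in> graph_ball V E y r"
    then show "u \<in> graph_ball V E x (r + real (graph_dist E x y))"
      using graph_dist_triangle[of x y u] assms by (simp add: graph_ball_iff)
  qed
qed (auto simp: graph_ball_iff less_imp_le vertex_weight_pos)

lemma n_step_nonneg: "x \<in> V \<Longrightarrow> 0 \<le> n_step E \<mu> n x z"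
proof (induction n arbitrary: x)
  case (Suc n)
  have "0 \<le> transition E \<mu> x y * n_step E \<mu> n y z" if "y \<in> E `` {x}" for y
  proof -
    have "y \<in> V" using that edge_vertices(2) by simp
    then show ?thesis
      using Suc weight_nonneg[of x y] vertex_weight_pos[of x] by (simp add: transition_def)
  qed
  then have "0 \<le> (\<Sum>y\<in>E `` {x}. transition E \<mu> x y * n_step E \<mu> n y z)" by (rule sum_nonneg)
  then show ?case by simp
qed simp

lemma n_step_support: "n_step E \<mu> n x z \<noteq> 0 \<Longrightarrow> (x, z) \<in> E ^^ n"
proof (induction n arbitrary: x)
  case (Suc n)
  then have "(\<Sum>y\<in>E `` {x}. transition E \<mu> x y * n_step E \<mu> n y z) \<noteq> 0" by simp
  then obtain y where "y \<in> E `` {x}" "transition E \<mu> x y * n_step E \<mu> n y z \<noteq> 0"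
    by (rule sum.not_neutral_contains_not_neutral)
  then have "(x, y) \<in> E" "(y, z) \<in> E ^^ n" using Suc.IH[of y] by auto
  then show ?case by (rule relpow_Suc_I2)
qed (simp split: if_splits)

lemma n_step_dist: "n_step E \<mu> n x z \<noteq> 0 \<Longrightarrow> graph_dist E z x \<le> n"
  by (rule graph_dist_le[OF relpow_sym[OF n_step_support]])

end

section \<open>The walk killed outside a ball around the root\<close>

locale rooted_ball = weighted_graph +
  fixes z :: 'a and N :: nat
  assumes root: "z \<in> V"
begin

abbreviation (input) B :: "'a set" where
  "B \<equiv> graph_ball V E z (real N)"

abbreviation (input) root_mass :: "'a \<Rightarrow> real" where
  "root_mass \<equiv> \<lambda>x. if x = z then 1 else 0"

text \<open>Edges leaving the ball are dropped, so near the boundary the row sums may fall below the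
  vertex weight.\<close>

sublocale killed: finite_reversible_dist B "vertex_weight E \<mu>"
  "\<lambda>x y. if (x, y) \<in> E then \<mu> x y else 0" "graph_dist E z" root_mass
proof
  fix x y assume x: "x \<in> B" and y: "y \<in> B"
  then have xV: "x \<in> V" and yV: "y \<in> V" by (auto simp: graph_ball_iff)
  show "0 < vertex_weight E \<mu> x" by (rule vertex_weight_pos[OF xV])
  show "0 \<le> (if (x, y) \<in> E then \<mu> x y else 0)" using weight_nonneg xV yV by auto
  show "(if (x, y) \<in> E then \<mu> x y else 0) = (if (y, x) \<in> E then \<mu> y x else 0)"
    using weight_sym[OF xV yV] symD[OF edges_sym] by auto
  show "(\<Sum>y\<in>B. if (x, y) \<in> E then \<mu> x y else 0) \<le> vertex_weight E \<mu> x"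
  proof -
    have "(\<Sum>y\<in>B. if (x, y) \<in> E then \<mu> x y else 0) = sum (\<mu> x) {y\<in>B. (x, y) \<in> E}"
      using finite_graph_ball[OF root] by (simp add: sum.inter_filter)
    also have "\<dots> \<le> sum (\<mu> x) (E `` {x})"
      using locally_finite[OF xV] weight_nonneg[OF xV] edges_subset by (intro sum_mono2) auto
    finally show ?thesis unfolding vertex_weight_def .
  qed
  show "graph_dist E z x \<le> Suc (graph_dist E z y)" if "(if (x, y) \<in> E then \<mu> x y else 0) \<noteq> 0"
    using that graph_dist_edge[OF root, of y x] symD[OF edges_sym, of x y] by (auto split: if_splits)
  show "graph_dist E z x = 0" if "root_mass x \<noteq> 0"
    using that by (auto simp: graph_dist_refl split: if_splits)
qed (rule finite_graph_ball[OF root])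

lemma root_in_ball: "z \<in> B"
  by (simp add: graph_ball_iff root graph_dist_refl)

lemma killed_P:
  assumes "x \<in> V" "\<And>y. (x, y) \<in> E \<Longrightarrow> y \<notin> B \<Longrightarrow> f y = 0"
  shows "killed.P f x = (\<Sum>y\<in>E `` {x}. transition E \<mu> x y * f y)"
proof -
  have "(\<Sum>y\<in>B. (if (x, y) \<in> E then \<mu> x y else 0) * f y) = (\<Sum>y\<in>{y\<in>B. (x, y) \<in> E}. \<mu> x y * f y)"
    using finite_graph_ball[OF root] by (subst sum.inter_filter) (auto intro!: sum.cong)
  also have "\<dots> = (\<Sum>y\<in>E `` {x}. \<mu> x y * f y)"
    using locally_finite[OF assms(1)] assms(2) by (intro sum.mono_neutral_left) auto
  finally show ?thesis
    unfolding killed.P_def transition_def by (simp add: sum_divide_distrib)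
qed

text \<open>Outside the ball the root is more than \<open>N\<close> steps away, so the functions up
  to time \<open>N\<close> vanish there and killing is invisible. One further application of
  \<open>P\<close> is still exact, hence \<open>Suc N\<close>.\<close>

lemma killed_P_pow: "n \<le> Suc N \<Longrightarrow> x \<in> V \<Longrightarrow> (killed.P ^^ n) root_mass x = n_step E \<mu> n x z"
proof (induction n arbitrary: x)
  case (Suc n)
  have "killed.P ((killed.P ^^ n) root_mass) x =
      (\<Sum>y\<in>E `` {x}. transition E \<mu> x y * (killed.P ^^ n) root_mass y)"
  proof (rule killed_P[OF Suc.prems(2)])
    fix y assume "(x, y) \<in> E" "y \<notin> B"
    then have "y \<in> V" "n < graph_dist E z y" using edge_vertices(2)[of x y] Suc.prems(1) by (auto simp: graph_ball_iff)
    then show "(killed.P ^^ n) root_mass y = 0"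
      using Suc.IH[of y] Suc.prems(1) n_step_dist[of n y z] by linarith
  qed
  also have "\<dots> = n_step E \<mu> (Suc n) x z"
  proof -
    have "(killed.P ^^ n) root_mass y = n_step E \<mu> n y z" if "y \<in> E `` {x}" for y
      using that Suc.IH[of y] Suc.prems(1) edge_vertices(2)[of x y] by auto
    then show ?thesis unfolding n_step.simps by (intro sum.cong) simp_all
  qed
  finally show ?case by simp
qed simp

lemma inner_n_step:
  assumes "j \<le> N" "k \<le> N"
  shows "killed.inner_S ((killed.P ^^ j) root_mass) ((killed.P ^^ k) root_mass)
     = (\<Sum>x\<in>B. vertex_weight E \<mu> x * n_step E \<mu> j x z * n_step E \<mu> k x z)"
  unfolding killed.inner_S_def using assms
  by (intro sum.cong) (auto simp: killed_P_pow graph_ball_iff)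

text \<open>Both factors end at \<open>z\<close>; self-adjointness turns one of them around, and the
  sum becomes a Chapman-Kolmogorov sum for the closed walk.\<close>

lemma n_step_chapman_kolmogorov:
  assumes "j + k \<le> N"
  shows "(\<Sum>x\<in>B. vertex_weight E \<mu> x * n_step E \<mu> j x z * n_step E \<mu> k x z)
     = vertex_weight E \<mu> z * n_step E \<mu> (j + k) z z"
proof -
  have "(\<Sum>x\<in>B. vertex_weight E \<mu> x * n_step E \<mu> j x z * n_step E \<mu> k x z)
     = killed.inner_S root_mass ((killed.P ^^ (j + k)) root_mass)"
    using assms inner_n_step[of j k] by (simp add: killed.P_pow_self_adjoint funpow_add)
  also have "\<dots> = (\<Sum>x\<in>B. if x = z then vertex_weight E \<mu> x * (killed.P ^^ (j + k)) root_mass x else 0)"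
    unfolding killed.inner_S_def by (intro sum.cong) auto
  also have "\<dots> = vertex_weight E \<mu> z * n_step E \<mu> (j + k) z z"
    using root_in_ball root assms killed_P_pow[of "j + k" z] finite_graph_ball[OF root]
    by (simp add: sum.delta)
  finally show ?thesis .
qed

text \<open>By reversibility this is conservation of probability for the walk started at
  \<open>z\<close>: before time \<open>N\<close> it has not yet been killed.\<close>

lemma n_step_mass:
  "n \<le> N \<Longrightarrow> (\<Sum>x\<in>B. vertex_weight E \<mu> x * n_step E \<mu> n x z) = vertex_weight E \<mu> z"
proof (induction n)
  case 0
  then show ?case using root_in_ball finite_graph_ball[OF root] by (simp add: if_distrib sum.delta cong: if_cong)
next
  case (Suc n)
  let ?g = "(killed.P ^^ n) root_mass"
  have "(\<Sum>x\<in>B. vertex_weight E \<mu> x * n_step E \<mu> (Suc n) x z) = killed.inner_S (killed.P ?g) (\<lambda>_. 1)"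
    unfolding killed.inner_S_def using Suc.prems killed_P_pow[of "Suc n"]
    by (intro sum.cong) (auto simp: graph_ball_iff)
  also have "\<dots> = killed.inner_S ?g (killed.P (\<lambda>_. 1))"
    by (rule killed.P_self_adjoint)
  also have "\<dots> = (\<Sum>x\<in>B. vertex_weight E \<mu> x * n_step E \<mu> n x z)"
    unfolding killed.inner_S_def
  proof (intro sum.cong refl)
    fix x assume "x \<in> B"
    then have x: "x \<in> V" by (simp add: graph_ball_iff)
    have g: "?g x = n_step E \<mu> n x z" using killed_P_pow[of n x] Suc.prems x by simp
    \<comment> \<open>Where the \<open>n\<close>-step function is nonzero, every neighbour is within
      \<open>Suc n \<le> N\<close> of the root, so no edge was dropped.\<close>
    have "killed.P (\<lambda>_. 1) x = 1" if "?g x \<noteq> 0"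
    proof -
      have "graph_dist E z x \<le> n" using that n_step_dist g by simp
      then have "y \<in> B" if "(x, y) \<in> E" for y
        using that graph_dist_edge[OF root that] edge_vertices(2)[OF that] Suc.prems
        by (auto simp: graph_ball_iff)
      then have "killed.P (\<lambda>_. 1) x = (\<Sum>y\<in>E `` {x}. \<mu> x y / vertex_weight E \<mu> x)"
        using killed_P[OF x, of "\<lambda>_. 1"] by (simp add: transition_def)
      then show ?thesis
        using vertex_weight_pos[OF x] by (simp add: vertex_weight_def flip: sum_divide_distrib)
    qed
    then show "vertex_weight E \<mu> x * ?g x * killed.P (\<lambda>_. 1) x = vertex_weight E \<mu> x * n_step E \<mu> n x z"
      using g by auto
  qed
  finally show ?case using Suc by simp
qed

end

section \<open>Lower bounds for return probabilities and for the Green function\<close>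

context weighted_graph
begin

text \<open>By \<open>small\<close>, at least half of the mass is within distance \<open>r\<close>
  at time \<open>n\<close>. Cauchy-Schwarz on that ball compares this half with the squared L2 norm,
  which is the return probability at time \<open>2 * n\<close> up to the weight of
  \<open>z\<close>.\<close>

lemma return_probability_lower:
  assumes z: "z \<in> V" and r: "0 \<le> r" "r \<le> 2 * real n"
    and small: "2 * sqrt (volume z (real n) * vertex_weight E \<mu> z) * exp (- r\<^sup>2 / (4 * real n))
      \<le> vertex_weight E \<mu> z / 2"
  shows "vertex_weight E \<mu> z \<le> 4 * volume z r * n_step E \<mu> (2 * n) z z"
proof -
  \<comment> \<open>Radius \<open>2 * n\<close> is what Chapman-Kolmogorov for \<open>n + n\<close>
    steps requires.\<close>
  interpret rooted_ball V E \<mu> z "2 * n" by unfold_locales (rule z)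
  let ?m = "vertex_weight E \<mu>" and ?f = "\<lambda>x. n_step E \<mu> n x z"
  have f: "(killed.P ^^ n) root_mass x = ?f x" "0 \<le> ?f x" if "x \<in> B" for x
    using that killed_P_pow[of n x] n_step_nonneg[of x] by (auto simp: graph_ball_iff)
  have "(\<Sum>x | x \<in> B \<and> r < real (graph_dist E z x). ?m x * ?f x)
    = (\<Sum>x | x \<in> B \<and> r < real (graph_dist E z x). ?m x * \<bar>(killed.P ^^ n) root_mass x\<bar>)"
    using f by (intro sum.cong) auto
  also have "\<dots> \<le> 2 * sqrt (sum ?m {x\<in>B. graph_dist E z x \<le> n} * killed.inner_S root_mass root_mass)
      * exp (- r\<^sup>2 / (4 * real n))"
    by (rule killed.P_pow_tail[OF r])
  also have "{x\<in>B. graph_dist E z x \<le> n} = graph_ball V E z (real n)"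
    by (auto simp: graph_ball_iff)
  also have "killed.inner_S root_mass root_mass = ?m z"
    using inner_n_step[of 0 0] n_step_chapman_kolmogorov[of 0 0] by simp
  finally have "(\<Sum>x | x \<in> B \<and> r < real (graph_dist E z x). ?m x * ?f x) \<le> ?m z / 2"
    using small by (simp add: volume_def)
  moreover have "(\<Sum>x\<in>B. ?m x * ?f x) = (\<Sum>x | x \<in> B \<and> r < real (graph_dist E z x). ?m x * ?f x)
      + (\<Sum>x | x \<in> B \<and> real (graph_dist E z x) \<le> r. ?m x * ?f x)"
    by (subst sum.union_disjoint[symmetric]) (auto simp: finite_graph_ball[OF z] intro!: sum.cong)
  moreover have "(\<Sum>x\<in>B. ?m x * ?f x) = ?m z"
    by (rule n_step_mass) simp
  ultimately have "?m z / 2 \<le> (\<Sum>x | x \<in> B \<and> real (graph_dist E z x) \<le> r. ?m x * ?f x)"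
    by linarith
  also have "\<dots> = (\<Sum>x | x \<in> B \<and> real (graph_dist E z x) \<le> r. ?m x * \<bar>(killed.P ^^ n) root_mass x\<bar>)"
    using f by (intro sum.cong) auto
  also have "\<dots> \<le> sqrt (sum ?m {x \<in> B. real (graph_dist E z x) \<le> r} *
      killed.inner_S ((killed.P ^^ n) root_mass) ((killed.P ^^ n) root_mass))"
    by (rule killed.abs_sum_le_inner) (rule Collect_restrict)
  also have "killed.inner_S ((killed.P ^^ n) root_mass) ((killed.P ^^ n) root_mass)
      = ?m z * n_step E \<mu> (2 * n) z z"
    using inner_n_step[of n n] n_step_chapman_kolmogorov[of n n] by (simp only: mult_2 le_add1 order_refl)
  finally have "(?m z / 2)\<^sup>2 \<le> sum ?m {x \<in> B. real (graph_dist E z x) \<le> r} * (?m z * n_step E \<mu> (2 * n) z z)"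
    using vertex_weight_pos[OF z] sqrt_ge_absD by fastforce
  also have "\<dots> \<le> volume z r * (?m z * n_step E \<mu> (2 * n) z z)"
  proof (rule mult_right_mono)
    show "sum ?m {x \<in> B. real (graph_dist E z x) \<le> r} \<le> volume z r"
      unfolding volume_def
      by (intro sum_mono2 finite_graph_ball z) (auto simp: graph_ball_iff less_imp_le vertex_weight_pos)
    show "0 \<le> ?m z * n_step E \<mu> (2 * n) z z"
      using n_step_nonneg[OF z, of "2 * n" z] vertex_weight_pos[OF z] by simp
  qed
  finally have "?m z * ?m z \<le> ?m z * (4 * volume z r * n_step E \<mu> (2 * n) z z)"
    by (simp add: power2_eq_square mult_ac)
  then show ?thesis using vertex_weight_pos[OF z] by simp
qed

lemma heat_kernel_nonneg: "x \<in> V \<Longrightarrow> z \<in> V \<Longrightarrow> 0 \<le> heat_kernel E \<mu> n x z"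
  unfolding heat_kernel_def using n_step_nonneg vertex_weight_pos by (simp add: less_imp_le)

text \<open>Here \<open>s\<close> plays the role of q - 1. For fixed \<open>k\<close> the weights
  \<open>?m x * ?h k x\<close> form a probability vector, and the mean of \<open>?G\<close> under it
  is a sum of return kernels. Jensen is applied for each \<open>k\<close>; summing over
  \<open>k\<close> restores the factor \<open>?G\<close>.\<close>

lemma green_norm_lower:
  assumes z: "z \<in> V" and s: "1 \<le> s"
  shows "(\<Sum>k<M. (\<Sum>j<M. heat_kernel E \<mu> (k + j) z z) powr s)
    \<le> (\<Sum>x\<in>graph_ball V E z (real (2 * M)).
          (\<Sum>k<M. heat_kernel E \<mu> k x z) powr (s + 1) * vertex_weight E \<mu> x)"
proof -
  interpret rooted_ball V E \<mu> z "2 * M" by unfold_locales (rule z)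
  let ?m = "vertex_weight E \<mu>" and ?h = "\<lambda>k x. heat_kernel E \<mu> k x z"
  let ?G = "\<lambda>x. \<Sum>k<M. ?h k x"
  have mz: "?m z > 0" by (rule vertex_weight_pos[OF z])
  have h: "0 \<le> ?h k x" "0 < ?m x" if "x \<in> B" for k x
    using that z heat_kernel_nonneg vertex_weight_pos by (auto simp: graph_ball_iff)
  have "(\<Sum>j<M. ?h (k + j) z) powr s \<le> (\<Sum>x\<in>B. ?m x * ?h k x * ?G x powr s)" if "k < M" for k
  proof -
    have "(\<Sum>x\<in>B. ?m x * ?h k x * ?G x) = (\<Sum>j<M. \<Sum>x\<in>B. ?m x * ?h k x * ?h j x)"
      unfolding sum_distrib_left by (rule sum.swap)
    also have "\<dots> = (\<Sum>j<M. ?h (k + j) z)"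
    proof (intro sum.cong refl)
      fix j assume "j \<in> {..<M}"
      then have "(\<Sum>x\<in>B. ?m x * n_step E \<mu> k x z * n_step E \<mu> j x z) = ?m z * n_step E \<mu> (k + j) z z"
        using that by (intro n_step_chapman_kolmogorov) auto
      then have "(\<Sum>x\<in>B. ?m x * n_step E \<mu> k x z * n_step E \<mu> j x z) / (?m z * ?m z) = ?h (k + j) z"
        using mz by (simp add: heat_kernel_def)
      then show "(\<Sum>x\<in>B. ?m x * ?h k x * ?h j x) = ?h (k + j) z"
        by (simp add: heat_kernel_def sum_divide_distrib)
    qed
    finally have *: "(\<Sum>x\<in>B. ?m x * ?h k x * ?G x) = (\<Sum>j<M. ?h (k + j) z)" .
    have "(\<Sum>x\<in>B. ?m x * ?h k x) = (\<Sum>x\<in>B. ?m x * n_step E \<mu> k x z) / ?m z"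
      by (simp add: heat_kernel_def sum_divide_distrib)
    also have "\<dots> = 1" using that n_step_mass[of k] mz by simp
    finally show ?thesis
      unfolding *[symmetric] using s h by (intro powr_jensen) (auto intro!: sum_nonneg simp: less_imp_le)
  qed
  then have "(\<Sum>k<M. (\<Sum>j<M. ?h (k + j) z) powr s) \<le> (\<Sum>k<M. \<Sum>x\<in>B. ?m x * ?h k x * ?G x powr s)"
    by (intro sum_mono) auto
  also have "\<dots> = (\<Sum>x\<in>B. \<Sum>k<M. ?h k x * (?m x * ?G x powr s))"
    by (subst sum.swap) (simp add: mult_ac)
  also have "\<dots> = (\<Sum>x\<in>B. ?G x * ?G x powr s * ?m x)"
    unfolding sum_distrib_right[symmetric] by (simp add: mult_ac)
  also have "\<dots> = (\<Sum>x\<in>B. ?G x powr (s + 1) * ?m x)"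
    using h by (intro sum.cong refl) (simp add: powr_mult_base sum_nonneg add.commute)
  finally show ?thesis .
qed

end

section \<open>Volume growth and divergence of the return series\<close>

text \<open>Condensation leads to the harmonic series. Without the factor 2 the value at 1 would be
  \<open>1 / 0 = 0\<close>, and monotonicity would fail.\<close>

lemma not_summable_inverse_mult_ln: "\<not> summable (\<lambda>k. 1 / (real k * ln (2 * real k)))"
proof -
  let ?f = "\<lambda>k. 1 / (real k * ln (2 * real k))"
  have "summable ?f \<longleftrightarrow> summable (\<lambda>n. 2 ^ n * ?f (2 ^ n))"
  proof (rule condensation_test)
    fix m :: nat assume "0 < m"
    then show "?f (Suc m) \<le> ?f m"
      by (intro divide_left_mono mult_mono mult_pos_pos) auto
  next
    show "0 \<le> ?f n" for n by (cases n) auto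
  qed
  also have "(\<lambda>n. 2 ^ n * ?f (2 ^ n)) = (\<lambda>n. (1 / ln 2) * (1 / real (Suc n)))"
  proof
    fix n
    have "ln (2 * 2 ^ n :: real) = real (Suc n) * ln 2"
      by (metis ln_realpow power_Suc zero_less_numeral)
    then show "2 ^ n * ?f (2 ^ n) = (1 / ln 2) * (1 / real (Suc n))"
      by (simp del: of_nat_Suc add: divide_simps)
  qed
  also have "\<not> summable (\<lambda>n. (1 / ln 2) * (1 / real (Suc n)))"
    using not_summable_harmonic[where 'a = real] summable_Suc_iff[of "\<lambda>n. inverse (real n)"]
    by (subst summable_cmult_iff) (simp add: inverse_eq_divide)
  finally show ?thesis .
qed

lemma sum_le_infsum_ennreal:
  fixes f :: "'a \<Rightarrow> ennreal"
  assumes "finite B" "B \<subseteq> A"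
  shows "sum f B \<le> infsum f A"
proof -
  have "infsum f B \<le> infsum f A"
    by (rule infsum_mono_neutral) (use assms in \<open>auto intro!: nonneg_summable_on_complete\<close>)
  then show ?thesis using assms(1) by simp
qed

context weighted_graph
begin

lemma return_probability_asymp:
  assumes z: "z \<in> V" and p: "0 < p" and C: "0 < C"
    and vol: "\<forall>\<^sub>F r in at_top. volume z r \<le> C * (r powr (2 * p) / ln r)"
  shows "\<exists>c>0. \<forall>\<^sub>F n in sequentially.
    c * (real n * ln (real n)) powr (- p) * ln (real n) \<le> n_step E \<mu> (2 * n) z z"
proof -
  \<comment> \<open>With r^2 = K n ln n the Gaussian factor is n^(-(p + 1)), one power of n better
    than the n^p coming from the square root of the volume.\<close>
  define K where "K = 4 * (p + 1)"
  define r where "r n = sqrt (K * (real n * ln (real n)))" for n :: nat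
  define m where "m = vertex_weight E \<mu> z"
  \<comment> \<open>The 8 collects the 4 of \<open>return_probability_lower\<close> and a 2 from ln
    r >= (ln n) / 2.\<close>
  define D where "D = 8 * C * K powr p"
  have K: "1 < K" using p by (simp add: K_def)
  have m: "0 < m" unfolding m_def by (rule vertex_weight_pos[OF z])
  have D: "0 < D" using C K by (simp add: D_def)
  have "filterlim r at_top sequentially" unfolding r_def using K by real_asymp
  from eventually_compose_filterlim[OF vol this]
  have ev1: "\<forall>\<^sub>F n in sequentially. volume z (r n) \<le> C * (r n powr (2 * p) / ln (r n))" .
  have ev2: "\<forall>\<^sub>F n in sequentially. volume z (real n) \<le> C * (real n powr (2 * p) / ln (real n))"
    by (rule eventually_compose_filterlim[OF vol filterlim_real_sequentially])
  have ev3: "\<forall>\<^sub>F n in sequentially. r n \<le> 2 * real n"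
    unfolding r_def using K by real_asymp
  have ev4: "\<forall>\<^sub>F n in sequentially. 1 \<le> ln (real n)" by real_asymp
  \<comment> \<open>This is what remains of the escape bound after the powers of n cancel.\<close>
  have "(\<lambda>n. 2 * sqrt (C * m) / real n) \<longlonglongrightarrow> 0" using C m by real_asymp
  then have ev5: "\<forall>\<^sub>F n in sequentially. 2 * sqrt (C * m) / real n < m / 2"
    by (rule order_tendstoD) (use m in simp)
  have "\<forall>\<^sub>F n in sequentially. (m / D) * (real n * ln (real n)) powr (- p) * ln (real n) \<le> n_step E \<mu> (2 * n) z z"
    using ev1 ev2 ev3 ev4 ev5 eventually_gt_at_top[of 1]
  proof eventually_elim
    case (elim n)
    define L where "L = real n * ln (real n)"
    have n: "1 < real n" using elim by simp
    have L: "real n \<le> L" using elim n by (simp add: L_def)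
    have r_sq: "(r n)\<^sup>2 = K * L" using K L n by (simp add: r_def L_def)
    have r_pos: "0 < r n" using K L n by (simp add: r_def L_def)
    have f: "0 \<le> n_step E \<mu> (2 * n) z z" by (rule n_step_nonneg[OF z])
    have vol_n: "volume z (real n) \<le> C * real n powr (2 * p)"
    proof -
      have "real n powr (2 * p) / ln (real n) \<le> real n powr (2 * p) / 1"
        using elim by (intro divide_left_mono) auto
      from mult_left_mono[OF this, of C] show ?thesis using elim(2) C by simp
    qed
    have e1: "exp (- (r n)\<^sup>2 / (4 * real n)) = real n powr (- (p + 1))"
      using n unfolding r_sq by (simp add: K_def L_def powr_def field_simps)
    have "sqrt (volume z (real n) * m) \<le> sqrt ((C * real n powr (2 * p)) * m)"
      using vol_n m by (intro real_sqrt_le_mono mult_right_mono) auto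
    also have "\<dots> = sqrt (C * m) * real n powr p"
      using n by (simp add: real_sqrt_mult powr_half_sqrt[symmetric] powr_powr)
    finally have e2: "sqrt (volume z (real n) * m) \<le> sqrt (C * m) * real n powr p" .
    have "2 * sqrt (volume z (real n) * m) * exp (- (r n)\<^sup>2 / (4 * real n))
        \<le> 2 * (sqrt (C * m) * real n powr p) * real n powr (- (p + 1))"
      unfolding e1 by (intro mult_right_mono mult_left_mono e2) auto
    also have "\<dots> = 2 * sqrt (C * m) * real n powr (p + - (p + 1))"
      unfolding powr_add[of "real n" p] by simp
    also have "\<dots> = 2 * sqrt (C * m) / real n"
      using n by (simp add: powr_minus divide_simps)
    also have "\<dots> \<le> m / 2" using elim by simp
    finally have "m \<le> 4 * volume z (r n) * n_step E \<mu> (2 * n) z z"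
      unfolding m_def using elim r_pos by (intro return_probability_lower[OF z]) auto
    also have "\<dots> \<le> 4 * (C * (K powr p * L powr p * 2 / ln (real n))) * n_step E \<mu> (2 * n) z z"
    proof (intro mult_right_mono mult_left_mono f)
      \<comment> \<open>Since r^2 >= n, the logarithm in the volume bound is still comparable to ln
        n at radius \<open>r n\<close>.\<close>
      have ln_r: "ln (real n) / 2 \<le> ln (r n)"
      proof -
        have "real n * 1 \<le> L * K" using L K n by (intro mult_mono) auto
        then have "ln (real n) \<le> ln ((r n)\<^sup>2)" using n unfolding r_sq by (simp add: mult.commute)
        then show ?thesis using r_pos by (simp add: ln_realpow)
      qed
      have "r n powr (2 * p) = ((r n)\<^sup>2) powr p"
        using r_pos by (simp add: powr_powr flip: powr_numeral)
      also have "\<dots> = K powr p * L powr p" unfolding r_sq using K L n by (simp add: powr_mult)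
      finally have rp: "r n powr (2 * p) = K powr p * L powr p" .
      have "volume z (r n) \<le> C * (K powr p * L powr p / ln (r n))"
        using elim(1) unfolding rp .
      also have "\<dots> \<le> C * (K powr p * L powr p / (ln (real n) / 2))"
        using C ln_r elim by (intro mult_left_mono divide_left_mono) auto
      finally show "volume z (r n) \<le> C * (K powr p * L powr p * 2 / ln (real n))" by simp
    qed simp
    also have "\<dots> = D * L powr p / ln (real n) * n_step E \<mu> (2 * n) z z"
      by (simp add: D_def)
    finally have "m * (ln (real n) / (D * L powr p)) \<le>
        (D * L powr p / ln (real n) * n_step E \<mu> (2 * n) z z) * (ln (real n) / (D * L powr p))"
      using elim D by (intro mult_right_mono) auto
    also have "\<dots> = n_step E \<mu> (2 * n) z z"
      using D L n elim by (simp add: field_simps)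
    finally show ?case
      unfolding L_def[symmetric] by (simp add: powr_minus divide_simps)
  qed
  then show ?thesis using m D by (intro exI[of _ "m / D"]) auto
qed

text \<open>Only the even times \<open>2 * i\<close> with k <= i < 2k are kept in the inner sum.
  These k terms add up to at least a constant times (k ln 2k)^(1 - p), and the power 1 / (p - 1)
  turns this into 1 / (k ln 2k).\<close>

lemma return_sum_unbounded:
  assumes z: "z \<in> V" and p: "1 < p" and C: "0 < C"
    and vol: "\<forall>\<^sub>F r in at_top. volume z r \<le> C * (r powr (2 * p) / ln r)"
  shows "\<exists>M. A < (\<Sum>k<M. (\<Sum>j<M. heat_kernel E \<mu> (k + j) z z) powr (1 / (p - 1)))"
proof (rule ccontr)
  assume "\<nexists>M. A < (\<Sum>k<M. (\<Sum>j<M. heat_kernel E \<mu> (k + j) z z) powr (1 / (p - 1)))"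
  then have bound: "(\<Sum>k<M. (\<Sum>j<M. heat_kernel E \<mu> (k + j) z z) powr (1 / (p - 1))) \<le> A" for M
    by (auto simp: not_less)
  let ?s = "1 / (p - 1)" and ?a = "\<lambda>i. heat_kernel E \<mu> i z z"
  have a: "0 \<le> ?a i" for i by (rule heat_kernel_nonneg[OF z z])
  have mz: "0 < vertex_weight E \<mu> z" by (rule vertex_weight_pos[OF z])
  obtain c' where c': "0 < c'" and "\<forall>\<^sub>F n in sequentially.
      c' * (real n * ln (real n)) powr (- p) * ln (real n) \<le> n_step E \<mu> (2 * n) z z"
    using return_probability_asymp[OF z _ C vol] p by auto
  then obtain n0 where n0: "\<And>n. n0 \<le> n \<Longrightarrow>
      c' * (real n * ln (real n)) powr (- p) * ln (real n) \<le> n_step E \<mu> (2 * n) z z"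
    by (auto simp: eventually_sequentially)
  \<comment> \<open>The factor \<open>2 powr (- p)\<close> pays for replacing i by its upper bound
    2k.\<close>
  define c where "c = c' / vertex_weight E \<mu> z * 2 powr (- p)"
  have c: "0 < c" using c' mz by (simp add: c_def)
  \<comment> \<open>The bound 3 ensures \<open>exp 1 \<le> real i\<close>, hence ln i >= 1;
    \<open>3 * k \<le> M\<close> leaves room for all offsets \<open>2 * i - k\<close>.\<close>
  have term_bound: "c powr ?s * (1 / (real k * ln (2 * real k))) \<le> (\<Sum>j<M. ?a (k + j)) powr ?s"
    if k: "max n0 3 \<le> k" and M: "3 * k \<le> M" for k M
  proof -
    define l where "l = ln (2 * real k)"
    have l: "1 \<le> l"
    proof -
      have "exp 1 \<le> 2 * real k" using exp_le k by linarith
      then show ?thesis using k by (simp add: l_def ln_ge_iff)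
    qed
    have "c * (real k * l) powr (1 - p) = (\<Sum>i\<in>{k..<2*k}. c * real k powr (- p) * l powr (1 - p))"
      using k l by (simp add: powr_mult powr_diff powr_minus divide_simps)
    also have "\<dots> \<le> (\<Sum>i\<in>{k..<2*k}. ?a (2 * i))"
    proof (rule sum_mono)
      fix i assume i: "i \<in> {k..<2*k}"
      have i3: "3 \<le> i" using i k by simp
      have "exp 1 \<le> real i" using exp_le i3 by linarith
      then have li: "1 \<le> ln (real i)" using i3 by (simp add: ln_ge_iff)
      have lil: "ln (real i) \<le> l" using i i3 unfolding l_def by simp
      have "c * real k powr (- p) * l powr (1 - p)
        = c' / vertex_weight E \<mu> z * ((2 * real k) powr (- p) * l powr (1 - p))"
        by (simp add: c_def powr_mult)
      \<comment> \<open>Both exponents are negative, so the upper bounds i <= 2k and ln i <= l yield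
        lower bounds for the powers.\<close>
      also have "\<dots> \<le> c' / vertex_weight E \<mu> z * (real i powr (- p) * ln (real i) powr (1 - p))"
        using i i3 li lil c' mz p
        by (intro mult_left_mono mult_mono powr_mono2') auto
      also have "real i powr (- p) * ln (real i) powr (1 - p)
        = (real i * ln (real i)) powr (- p) * ln (real i)"
        using li i3 by (simp add: powr_mult powr_diff powr_minus divide_simps)
      also have "c' / vertex_weight E \<mu> z * \<dots>
        = c' * (real i * ln (real i)) powr (- p) * ln (real i) / vertex_weight E \<mu> z"
        by simp
      also have "\<dots> \<le> ?a (2 * i)"
        unfolding heat_kernel_def using n0[of i] i k mz by (intro divide_right_mono) auto
      finally show "c * real k powr (- p) * l powr (1 - p) \<le> ?a (2 * i)" .
    qed
    also have "\<dots> = (\<Sum>j\<in>(\<lambda>i. 2 * i - k) ` {k..<2*k}. ?a (k + j))"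
      by (subst sum.reindex) (auto simp: inj_on_def intro!: sum.cong)
    also have "\<dots> \<le> (\<Sum>j<M. ?a (k + j))"
      using M a by (intro sum_mono2) auto
    finally have "(c * (real k * l) powr (1 - p)) powr ?s \<le> (\<Sum>j<M. ?a (k + j)) powr ?s"
      using c p by (intro powr_mono2) auto
    moreover have "(c * (real k * l) powr (1 - p)) powr ?s = c powr ?s * (real k * l) powr (- 1)"
    proof -
      have "(1 - p) * ?s = - 1" using p by (simp add: field_simps)
      then show ?thesis using c by (simp add: powr_mult powr_powr abs_mult)
    qed
    moreover have "(real k * l) powr (- 1) = 1 / (real k * l)"
      using k l by (simp add: powr_minus divide_simps)
    ultimately show ?thesis unfolding l_def by simp
  qed
  let ?t = "\<lambda>k. c powr ?s * (1 / (real k * ln (2 * real k)))" and ?k = "max n0 3"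
  have t: "0 \<le> ?t k" for k by (cases k) auto
  have "(\<Sum>k<n. ?t (k + ?k)) \<le> A" for n
  proof -
    have "(\<Sum>k<n. ?t (k + ?k)) = (\<Sum>k\<in>{?k..<n + ?k}. ?t k)"
      by (rule sum.reindex_bij_witness[of _ "\<lambda>k. k - ?k" "\<lambda>k. k + ?k"]) auto
    \<comment> \<open>One common truncation level, large enough for every index of the
      block.\<close>
    also have "\<dots> \<le> (\<Sum>k\<in>{?k..<n + ?k}. (\<Sum>j<3 * (n + ?k). ?a (k + j)) powr ?s)"
      by (intro sum_mono term_bound) auto
    also have "\<dots> \<le> (\<Sum>k<3 * (n + ?k). (\<Sum>j<3 * (n + ?k). ?a (k + j)) powr ?s)"
      by (intro sum_mono2) auto
    also have "\<dots> \<le> A" by (rule bound)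
    finally show ?thesis .
  qed
  then have "summable (\<lambda>k. ?t (k + ?k))"
    by (intro summableI_nonneg_bounded[where x = A] t)
  then have t: "summable ?t" by (rule iffD1[OF summable_iff_shift[of ?t ?k]])
  have "c powr ?s \<noteq> 0" using c by simp
  with t show False
    using not_summable_inverse_mult_ln summable_cmult_iff[of "c powr ?s"] by blast
qed

section \<open>Infinite norms of Green potentials and parabolicity\<close>

text \<open>The growth bound is given at one centre but is needed wherever f is positive. For large
  \<open>r\<close> the shift by the distance is absorbed in \<open>2 * r\<close>.\<close>

lemma volume_growth_shift:
  assumes x: "x \<in> V" and y: "y \<in> V" and p: "0 < p" and C: "0 < C"
    and vol: "\<forall>\<^sub>F r in at_top. volume x r \<le> C * (r powr (2 * p) / ln r)"
  shows "\<forall>\<^sub>F r in at_top. volume y r \<le> C * 2 powr (2 * p) * (r powr (2 * p) / ln r)"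
proof -
  let ?d = "real (graph_dist E x y)"
  have "filterlim (\<lambda>r::real. 2 * r) at_top at_top" by real_asymp
  from eventually_compose_filterlim[OF vol this]
  have "\<forall>\<^sub>F r in at_top. volume x (2 * r) \<le> C * ((2 * r) powr (2 * p) / ln (2 * r))" .
  then show ?thesis
    using eventually_ge_at_top[of ?d] eventually_gt_at_top[of 1]
  proof eventually_elim
    case (elim r)
    have "volume y r \<le> volume x (r + ?d)" by (rule volume_shift[OF x y])
    also have "\<dots> \<le> volume x (2 * r)" using elim by (intro volume_mono x) simp
    also have "\<dots> \<le> C * ((2 * r) powr (2 * p) / ln (2 * r))" by (rule elim)
    also have "\<dots> \<le> C * ((2 * r) powr (2 * p) / ln r)"
      using elim C by (intro mult_left_mono divide_left_mono mult_pos_pos) auto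
    also have "\<dots> = C * 2 powr (2 * p) * (r powr (2 * p) / ln r)"
      using elim by (simp add: powr_mult)
    finally show ?case .
  qed
qed

text \<open>Keeping the single source \<open>y\<close> and a partial sum of the Green series leaves
  a real number to work with.\<close>

lemma green_op_ge:
  assumes "y \<in> V" "x \<in> V" "0 \<le> f y"
  shows "ennreal ((\<Sum>k<M. heat_kernel E \<mu> k x y) * (f y * vertex_weight E \<mu> y)) \<le> green_op V E \<mu> f x"
proof -
  have "ennreal (\<Sum>k<M. heat_kernel E \<mu> k x y) = (\<Sum>k<M. ennreal (heat_kernel E \<mu> k x y))"
    using heat_kernel_nonneg[OF assms(2,1)] by (simp add: sum_ennreal)
  also have "\<dots> \<le> green E \<mu> x y"
    unfolding green_def by (rule sum_le_suminf) auto
  finally have "ennreal ((\<Sum>k<M. heat_kernel E \<mu> k x y) * (f y * vertex_weight E \<mu> y))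
      \<le> green E \<mu> x y * ennreal (f y) * ennreal (vertex_weight E \<mu> y)"
    using assms(3) vertex_weight_pos[OF assms(1)] heat_kernel_nonneg[OF assms(2,1)]
    by (simp add: ennreal_mult sum_nonneg mult.assoc mult_right_mono less_imp_le)
  also have "\<dots> = (\<Sum>y\<in>{y}. green E \<mu> x y * ennreal (f y) * ennreal (vertex_weight E \<mu> y))"
    by simp
  also have "\<dots> \<le> green_op V E \<mu> f x"
    unfolding green_op_def using assms by (intro sum_le_infsum_ennreal) auto
  finally show ?thesis .
qed

lemma ennreal_powr_mono:
  assumes "0 \<le> a" "0 < q" "ennreal a \<le> u"
  shows "ennreal (a powr q) \<le> ennreal_powr u q"
proof (cases "u = \<infinity>")
  case False
  then have "a \<le> enn2real u" using assms by (cases u) auto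
  then show ?thesis using False assms by (auto simp: ennreal_powr_def intro!: ennreal_leI powr_mono2)
qed (simp add: ennreal_powr_def)

lemma Lq_norm_green_op_infinite:
  assumes z: "z \<in> V" and fz: "0 < f z" and p: "1 < p" "p \<le> 2" and C: "0 < C"
    and vol: "\<forall>\<^sub>F r in at_top. volume z r \<le> C * (r powr (2 * p) / ln r)"
  shows "Lq_norm V E \<mu> (p / (p - 1)) (green_op V E \<mu> f) = \<infinity>"
proof -
  let ?q = "p / (p - 1)" and ?s = "1 / (p - 1)" and ?m = "vertex_weight E \<mu>"
  let ?I = "\<Sum>\<^sub>\<infinity>x\<in>V. ennreal_powr (green_op V E \<mu> f x) ?q * ennreal (?m x)"
  define c where "c = f z * ?m z"
  have c: "0 < c" using fz vertex_weight_pos[OF z] by (simp add: c_def)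
  \<comment> \<open>The assumption \<open>p \<le> 2\<close> enters here: \<open>?s\<close>, which is
    q - 1, must be at least 1 for Jensen.\<close>
  have q: "?s + 1 = ?q" "1 \<le> ?s" "0 < ?q" using p by (auto simp: field_simps)
  have lower: "ennreal (c powr ?q * (\<Sum>k<M. (\<Sum>j<M. heat_kernel E \<mu> (k + j) z z) powr ?s)) \<le> ?I" for M
  proof -
    let ?B = "graph_ball V E z (real (2 * M))" and ?G = "\<lambda>x. \<Sum>k<M. heat_kernel E \<mu> k x z"
    have B: "x \<in> V" if "x \<in> ?B" for x using that by (simp add: graph_ball_iff)
    have G: "0 \<le> ?G x" if "x \<in> V" for x by (intro sum_nonneg heat_kernel_nonneg that z)
    have "c powr ?q * (\<Sum>k<M. (\<Sum>j<M. heat_kernel E \<mu> (k + j) z z) powr ?s)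
      \<le> c powr ?q * (\<Sum>x\<in>?B. ?G x powr ?q * ?m x)"
      using green_norm_lower[OF z q(2), of M] unfolding q(1) by (intro mult_left_mono) auto
    also have "\<dots> = (\<Sum>x\<in>?B. (?G x * c) powr ?q * ?m x)"
      unfolding sum_distrib_left using B G c
      by (intro sum.cong refl) (simp add: powr_mult less_imp_le)
    finally have "ennreal (c powr ?q * (\<Sum>k<M. (\<Sum>j<M. heat_kernel E \<mu> (k + j) z z) powr ?s))
      \<le> ennreal (\<Sum>x\<in>?B. (?G x * c) powr ?q * ?m x)"
      by (rule ennreal_leI)
    also have "\<dots> = (\<Sum>x\<in>?B. ennreal ((?G x * c) powr ?q) * ennreal (?m x))"
      using B vertex_weight_pos by (simp add: less_imp_le flip: ennreal_mult sum_ennreal)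
    also have "\<dots> \<le> (\<Sum>x\<in>?B. ennreal_powr (green_op V E \<mu> f x) ?q * ennreal (?m x))"
      using green_op_ge[OF z, of _ f] B G fz c q unfolding c_def
      by (intro sum_mono mult_right_mono ennreal_powr_mono) auto
    also have "\<dots> \<le> ?I"
      using B by (intro sum_le_infsum_ennreal finite_graph_ball z) auto
    finally show ?thesis .
  qed
  have "?I = \<infinity>"
  proof (rule ccontr)
    assume "?I \<noteq> \<infinity>"
    then obtain A where A: "0 \<le> A" "?I = ennreal A" by (cases ?I) auto
    obtain M where "A / c powr ?q < (\<Sum>k<M. (\<Sum>j<M. heat_kernel E \<mu> (k + j) z z) powr ?s)"
      using return_sum_unbounded[OF z p(1) C vol] by blast
    then have "A < c powr ?q * (\<Sum>k<M. (\<Sum>j<M. heat_kernel E \<mu> (k + j) z z) powr ?s)"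
      using c by (simp add: field_simps)
    then show False using lower[of M] A by (simp add: ennreal_le_iff)
  qed
  then show ?thesis by (simp add: Lq_norm_def ennreal_powr_def)
qed

end

theorem theorem1p6:
  fixes V :: "'v set" and E :: "('v \<times> 'v) set" and \<mu> :: "'v \<Rightarrow> 'v \<Rightarrow> real"
    and p b :: real
  assumes "weighted_graph V E \<mu>"
    and "1 < p" and "p \<le> 2"
    and "0 < b" and "\<And>x. x \<in> V \<Longrightarrow> b \<le> vertex_weight E \<mu> x"
    and "\<exists>x0\<in>V. \<exists>C>0. \<forall>\<^sub>F r :: real in at_top.
           ball_volume V E \<mu> x0 r \<le> ennreal (C * (r powr (2 * p) / ln r))"
  shows "Lp_parabolic V E \<mu> p"
proof -
  interpret weighted_graph V E \<mu> by fact
  obtain x0 C where x0: "x0 \<in> V" and C: "0 < C"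
    and ev: "\<forall>\<^sub>F r in at_top. ball_volume V E \<mu> x0 r \<le> ennreal (C * (r powr (2 * p) / ln r))"
    using assms(6) by auto
  \<comment> \<open>For r > 1 the bound is nonnegative, so the comparison in \<open>ennreal\<close>
    descends to the reals.\<close>
  have vol: "\<forall>\<^sub>F r in at_top. volume x0 r \<le> C * (r powr (2 * p) / ln r)"
    using ev eventually_gt_at_top[of 1]
  proof eventually_elim
    case (elim r)
    then show ?case using C by (simp add: ball_volume_eq[OF x0] ennreal_le_iff)
  qed
  \<comment> \<open>An admissible function cannot be positive at any vertex of \<open>K\<close>, so
    the capacity is a supremum of zeros.\<close>
  have zero: "(\<Sum>x\<in>K. f x * vertex_weight E \<mu> x) = 0"
    if "K \<subseteq> V" and f: "\<forall>x. 0 \<le> f x" "Lq_norm V E \<mu> (p / (p - 1)) (green_op V E \<mu> f) \<le> 1" for K f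
  proof (rule sum.neutral, rule ballI)
    fix z assume "z \<in> K"
    then have z: "z \<in> V" using that by auto
    have "\<not> 0 < f z"
    proof
      assume "0 < f z"
      then have "Lq_norm V E \<mu> (p / (p - 1)) (green_op V E \<mu> f) = \<infinity>"
        using assms(2,3) C volume_growth_shift[OF x0 z _ C vol]
        by (intro Lq_norm_green_op_infinite[OF z, of f p "C * 2 powr (2 * p)"]) auto
      then show False using f(2) by (simp add: top_unique)
    qed
    then have "f z = 0" using f(1) by (simp add: order.antisym not_less)
    then show "f z * vertex_weight E \<mu> z = 0" by simp
  qed
  show ?thesis
    unfolding Lp_parabolic_def
  proof (intro allI impI)
    fix K assume "finite K \<and> K \<subseteq> V"
    then have "Lp_capacity V E \<mu> p K \<le> 0"
      unfolding Lp_capacity_def by (intro SUP_least) (auto simp: zero)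
    then show "Lp_capacity V E \<mu> p K = 0" by simp
  qed
qed

end
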